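(* Let $v_1, \dots, v_N \in \mathbb{R}^r$ be a Steiner equiangular tight frame constructed from a $(2, k, v)$-Steiner system and a Hadamard matrix of suitable size (as described in the context). Let $R \in \mathbb{R}^{r \times r}$ have entries $R_{m\ell} = \sum_{i=1}^N |(v_i)_m|^2 |(v_i)_\ell|^2$ for $m, \ell \in \{1, \dots, r\}$. Then $$\dim\left(\ker\left(\frac{1 - \frac{1}{r}}{1 - \frac{1}{N}} I_r + \frac{\frac{N}{r} - 1}{r\left(1 - \frac{1}{N}\right)} \mathbf{1}\mathbf{1}^\top - R\right)\right) = v.$$ When the Steiner system is a finite projective plane, the inequality $$R \preceq \frac{1 - \frac{1}{r}}{1 - \frac{1}{N}} I_r + \frac{\frac{N}{r} - 1}{r\left(1 - \frac{1}{N}\right)} \mathbf{1}\mathbf{1}^\top$$ (which holds for every equiangular tight frame of $N$ vectors in dimension $r$, with $R$ defined in the same way) is an equality of matrices.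
   Context: Unit vectors $v_1, \dots, v_N \in \mathbb{C}^r$ form an equiangular tight frame (ETF) if the nonzero eigenvalues of their Gram matrix $(\langle v_i, v_j\rangle)_{i,j=1}^N$ all equal $\frac{N}{r}$ and there exists $\alpha \in [0,1]$ such that $|\langle v_i, v_j \rangle| = \alpha$ whenever $i \neq j$. A $(2,k,v)$-Steiner system is a pair $(S, \mathcal{B})$ with $|S| = v$ and $\mathcal{B} \subseteq 2^S$ such that every $B \in \mathcal{B}$ has $|B| = k$ and, for every $C \subseteq S$ with $|C| = 2$, there exists a unique $B \in \mathcal{B}$ with $C \subseteq B$. Elements of $S$ are called points and elements of $\mathcal{B}$ are called blocks. The number of blocks is $b = |\mathcal{B}| = \frac{v(v-1)}{k(k-1)}$, and each point is contained in $\rho = \frac{v-1}{k-1}$ blocks. The incidence matrix is $M \in \{0,1\}^{v \times b}$, with entry 1 when the block contains the point and 0 otherwise. A $(2,k,v)$-Steiner system is called a finite projective plane if for any distinct $B, B' \in \mathcal{B}$ we have $|B \cap B'| = 1$, and there exist $w, x, y, z \in S$ such that no $B \in \mathcal{B}$ contains more than two of these points. A (complex) Hadamard matrix of size $n$ is a matrix $H \in \mathbb{C}^{n \times n}$ with $|H_{ij}| = 1$ for all $i,j$ and $H H^* = n I_n$. Steiner ETF construction: let $H \in \mathbb{C}^{(1+\rho)\times(1+\rho)}$ be a Hadamard matrix. For each $j = 1, \dots, v$, form the $b \times (1+\rho)$ matrix $V_j$ from the $j$th column of $M^\top$ by replacing every entry equal to 1 with a distinct row of $H$, and every entry equal to 0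 with a row of zeros. Set $V = \rho^{-1/2} [V_1 \cdots V_v]$, a $b \times v(1+\rho)$ matrix. Its columns $v_1, \dots, v_N$ are the Steiner ETF, with $r = b$ and $N = v(1+\rho)$. If $H$ is real-valued, the resulting ETF is also real. Here $\mathbf{1} \in \mathbb{R}^r$ is the all-ones vector, $I_r$ is the $r \times r$ identity matrix, and $A \preceq B$ means that $B - A$ is positive semidefinite.
   Formalization: The formal statement assumes 2 ≤ k < v: for k = v (a single block, r = 1, N = 2v) the matrix is the 1×1 zero matrix, so the kernel has dimension 1 rather than v, and for k < 2 the construction is undefined. *)

theory Defs
  imports
    "HOL-Analysis.Analysis"
    "Jordan_Normal_Form.Matrix_Kernel"
    "Jordan_Normal_Form.Char_Poly"
    "Jordan_Normal_Form.Schur_Decomposition"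
begin

text \<open>Families \<open>v_1, ..., v_N\<close> are indexed by \<open>{..<N}\<close>, and coordinates by \<open>{..<r}\<close>.\<close>

definition gram_matrix :: "nat \<Rightarrow> (nat \<Rightarrow> complex vec) \<Rightarrow> complex mat" where
  "gram_matrix N w = mat N N (\<lambda>(i, j). w i \<bullet>c w j)"

definition equiangular_tight_frame :: "nat \<Rightarrow> nat \<Rightarrow> (nat \<Rightarrow> complex vec) \<Rightarrow> bool" where
  "equiangular_tight_frame r N w \<longleftrightarrow>
     (\<forall>i<N. w i \<in> carrier_vec r \<and> w i \<bullet>c w i = 1) \<and>
     (\<forall>e. eigenvalue (gram_matrix N w) e \<and> e \<noteq> 0 \<longrightarrow> e = of_nat N / of_nat r) \<and>
     (\<exists>\<alpha>::real. 0 \<le> \<alpha> \<and> \<alpha> \<le> 1 \<and>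
        (\<forall>i<N. \<forall>j<N. i \<noteq> j \<longrightarrow> cmod (w i \<bullet>c w j) = \<alpha>))"

definition steiner_system :: "nat \<Rightarrow> nat \<Rightarrow> 'a set \<Rightarrow> 'a set set \<Rightarrow> bool" where
  "steiner_system k v S \<B> \<longleftrightarrow>
     finite S \<and> card S = v \<and> \<B> \<subseteq> Pow S \<and>
     (\<forall>B\<in>\<B>. card B = k) \<and>
     (\<forall>C. C \<subseteq> S \<and> card C = 2 \<longrightarrow> (\<exists>!B. B \<in> \<B> \<and> C \<subseteq> B))"

text \<open>The number of blocks through a point; the division is exact for a \<open>(2,k,v)\<close>-Steiner
  system with \<open>k \<ge> 2\<close> and \<open>v \<ge> 1\<close>.\<close>

definition replication :: "nat \<Rightarrow> nat \<Rightarrow> nat" where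
  "replication k v = (v - 1) div (k - 1)"

definition finite_projective_plane :: "nat \<Rightarrow> nat \<Rightarrow> 'a set \<Rightarrow> 'a set set \<Rightarrow> bool" where
  "finite_projective_plane k v S \<B> \<longleftrightarrow>
     steiner_system k v S \<B> \<and>
     (\<forall>B\<in>\<B>. \<forall>B'\<in>\<B>. B \<noteq> B' \<longrightarrow> card (B \<inter> B') = 1) \<and>
     (\<exists>w\<in>S. \<exists>x\<in>S. \<exists>y\<in>S. \<exists>z\<in>S. distinct [w, x, y, z] \<and>
        (\<forall>B\<in>\<B>. card (B \<inter> {w, x, y, z}) \<le> 2))"

definition hadamard :: "nat \<Rightarrow> complex mat \<Rightarrow> bool" where
  "hadamard n H \<longleftrightarrow>
     H \<in> carrier_mat n n \<and>
     (\<forall>i<n. \<forall>j<n. cmod (H $$ (i, j)) = 1) \<and>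
     H * mat_adjoint H = of_nat n \<cdot>\<^sub>m 1\<^sub>m n"

text \<open>\<open>pt\<close> and \<open>blk\<close> enumerate the \<open>v\<close> points and the \<open>b\<close> blocks.\<close>

definition incidence_matrix ::
  "nat \<Rightarrow> nat \<Rightarrow> (nat \<Rightarrow> 'a) \<Rightarrow> (nat \<Rightarrow> 'a set) \<Rightarrow> nat mat" where
  "incidence_matrix v b pt blk = mat v b (\<lambda>(j, m). if pt j \<in> blk m then 1 else 0)"

text \<open>\<open>s j m\<close> is the index of the row of \<open>H\<close> that replaces the entry 1 in row \<open>m\<close> of the
  \<open>j\<close>-th column of the transpose of \<open>M\<close>; for fixed \<open>j\<close> these indices are distinct.\<close>

definition row_choice :: "nat mat \<Rightarrow> nat \<Rightarrow> (nat \<Rightarrow> nat \<Rightarrow> nat) \<Rightarrow> bool" where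
  "row_choice M n s \<longleftrightarrow>
     (\<forall>j<dim_row M. inj_on (s j) {m. m < dim_col M \<and> M $$ (j, m) = 1} \<and>
        s j ` {m. m < dim_col M \<and> M $$ (j, m) = 1} \<subseteq> {..<n})"

definition steiner_block ::
  "nat mat \<Rightarrow> complex mat \<Rightarrow> (nat \<Rightarrow> nat \<Rightarrow> nat) \<Rightarrow> nat \<Rightarrow> complex mat" where
  "steiner_block M H s j =
     mat (dim_col M) (dim_col H) (\<lambda>(m, c). if M $$ (j, m) = 1 then H $$ (s j m, c) else 0)"

text \<open>Column \<open>i\<close> of the concatenation \<open>[V_1 ... V_v]\<close> is column \<open>i mod (1 + \<rho>)\<close> of the
  block with (zero-based) index \<open>i div (1 + \<rho>)\<close>.\<close>

definition steiner_matrix ::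
  "nat \<Rightarrow> nat mat \<Rightarrow> complex mat \<Rightarrow> (nat \<Rightarrow> nat \<Rightarrow> nat) \<Rightarrow> complex mat" where
  "steiner_matrix \<rho> M H s =
     complex_of_real (1 / sqrt (real \<rho>)) \<cdot>\<^sub>m
     mat (dim_col M) (dim_row M * (1 + \<rho>))
       (\<lambda>(m, i). steiner_block M H s (i div (1 + \<rho>)) $$ (m, i mod (1 + \<rho>)))"

definition steiner_etf ::
  "nat \<Rightarrow> nat \<Rightarrow> 'a set \<Rightarrow> 'a set set \<Rightarrow> (nat \<Rightarrow> complex vec) \<Rightarrow> bool" where
  "steiner_etf k v S \<B> w \<longleftrightarrow>
     (\<exists>pt blk H s.
        bij_betw pt {..<v} S \<and> bij_betw blk {..<card \<B>} \<B> \<and>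
        hadamard (1 + replication k v) H \<and>
        row_choice (incidence_matrix v (card \<B>) pt blk) (1 + replication k v) s \<and>
        (\<forall>i < v * (1 + replication k v).
           w i = col (steiner_matrix (replication k v)
                        (incidence_matrix v (card \<B>) pt blk) H s) i))"

definition R_matrix :: "nat \<Rightarrow> nat \<Rightarrow> (nat \<Rightarrow> complex vec) \<Rightarrow> real mat" where
  "R_matrix r N w =
     mat r r (\<lambda>(m, l). \<Sum>i<N. (cmod (w i $ m))\<^sup>2 * (cmod (w i $ l))\<^sup>2)"

text \<open>The all-ones matrix below is \<open>1 1^T\<close> for the all-ones vector \<open>1\<close>. The scalars have their
  intended meaning only for \<open>N \<ge> 2\<close> and \<open>r \<ge> 1\<close>, because of \<open>x / 0 = 0\<close>.\<close>

definition bound_matrix :: "nat \<Rightarrow> nat \<Rightarrow> real mat" where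
  "bound_matrix r N =
     ((1 - 1 / real r) / (1 - 1 / real N)) \<cdot>\<^sub>m 1\<^sub>m r +
     ((real N / real r - 1) / (real r * (1 - 1 / real N))) \<cdot>\<^sub>m mat r r (\<lambda>_. 1)"

definition positive_semidefinite :: "nat \<Rightarrow> real mat \<Rightarrow> bool" where
  "positive_semidefinite n A \<longleftrightarrow>
     A \<in> carrier_mat n n \<and> transpose_mat A = A \<and>
     (\<forall>x\<in>carrier_vec n. 0 \<le> x \<bullet> (A *\<^sub>v x))"

definition loewner_le :: "nat \<Rightarrow> real mat \<Rightarrow> real mat \<Rightarrow> bool" where
  "loewner_le n A B \<longleftrightarrow>
     A \<in> carrier_mat n n \<and> B \<in> carrier_mat n n \<and> positive_semidefinite n (B - A)"

end

theory Submission
  imports Defs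
begin

text \<open>
  Let \<open>M\<close> be the \<open>v \<times> b\<close> incidence matrix and \<open>\<rho>\<close> the number of blocks through a point. Every
  entry of \<open>H\<close> has modulus 1, so the squared moduli of the frame entries forget \<open>H\<close>: they are
  \<open>1/\<rho>\<close> times entries of \<open>M\<close>, each column of \<open>M\<^sup>T\<close> being repeated \<open>1 + \<rho>\<close> times. Hence
  \<open>R = g M\<^sup>T M\<close> with \<open>g = (1 + \<rho>) / \<rho>\<^sup>2\<close>. The identities \<open>v - 1 = \<rho> (k - 1)\<close> and \<open>b k = v \<rho>\<close>
  turn the two coefficients of the bound into \<open>a = g (\<rho> - 1)\<close> and \<open>c = g k / \<rho>\<close>
  (\<open>steiner_scalars\<close>).

  Two points lie in exactly one common block, so \<open>M M\<^sup>T = (\<rho> - 1) I + J\<close>, which is invertible.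
  Thus \<open>M\<^sup>T\<close> is injective. With the values of \<open>a\<close> and \<open>c\<close> above, \<open>a I + c J - R\<close> vanishes on
  the range of \<open>M\<^sup>T\<close>; conversely a kernel vector \<open>x\<close> satisfies \<open>a x = R x - c J x\<close>, whose right
  side lies in that range because \<open>M\<^sup>T\<close> maps the all-ones vector to \<open>k\<close> times the all-ones vector.
  So the kernel is a copy of the \<open>v\<close>-dimensional space (\<open>incidence_kernel_dim\<close>). In a projective
  plane two blocks meet in one point, so \<open>M\<^sup>T M = (k - 1) I + J\<close>; comparing row sums and
  using \<open>b k = v \<rho>\<close> yields \<open>\<rho> = k\<close>, and the two matrices agree entry by entry.

  For a general equiangular tight frame the bound is Bessel's inequality for the rank-one
  projections \<open>P\<^sub>i = v\<^sub>i v\<^sub>i\<^sup>*\<close>. If \<open>D\<close> is the diagonal matrix of \<open>x\<close>, then \<open>x\<^sup>T R x\<close> is the sum of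
  the squared Hilbert-Schmidt products \<open>\<langle>D, P\<^sub>i\<rangle>\<close>, and equiangularity says that the \<open>P\<^sub>i\<close> have Gram
  matrix \<open>(1 - \<alpha>\<^sup>2) I + \<alpha>\<^sup>2 J\<close>. After subtracting the scalar part of \<open>D\<close>, the component along \<open>J\<close>
  drops out and Cauchy-Schwarz gives the constant \<open>1 - \<alpha>\<^sup>2 = a\<close> (\<open>etf_quadratic_form_le\<close>). The
  value of \<open>\<alpha>\<close> and the tightness used here follow from the eigenvalue hypothesis through
  \<open>tr G\<^sup>2 = (N/r) tr G\<close> (\<open>trace_square_eq_trace\<close>, \<open>etf_welch_and_tight\<close>).
\<close>

section \<open>Traces and eigenvalues\<close>

definition mat_trace :: "'a::comm_ring_1 mat \<Rightarrow> 'a" where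
  "mat_trace A = (\<Sum>i<dim_row A. A $$ (i, i))"

lemma mat_trace_mult:
  fixes A B :: "'a::comm_ring_1 mat"
  assumes "A \<in> carrier_mat n m" "B \<in> carrier_mat m n"
  shows "mat_trace (A * B) = (\<Sum>i<n. \<Sum>j<m. A $$ (i, j) * B $$ (j, i))"
proof -
  have "mat_trace (A * B) = (\<Sum>i<n. \<Sum>j = 0..<m. A $$ (i, j) * B $$ (j, i))"
    unfolding mat_trace_def using assms
    by (intro sum.cong) (auto simp: scalar_prod_def)
  then show ?thesis by (simp add: lessThan_atLeast0)
qed

lemma mat_trace_comm:
  fixes A B :: "'a::comm_ring_1 mat"
  assumes "A \<in> carrier_mat n m" "B \<in> carrier_mat m n"
  shows "mat_trace (A * B) = mat_trace (B * A)"
  unfolding mat_trace_mult[OF assms] mat_trace_mult[OF assms(2,1)]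
  by (subst sum.swap) (simp add: mult.commute)

lemma mat_trace_similar:
  fixes A B :: "'a::comm_ring_1 mat"
  assumes "similar_mat_wit A B P Q" "A \<in> carrier_mat n n"
  shows "mat_trace A = mat_trace B"
proof -
  note wit = similar_mat_witD2[OF assms(2,1)]
  have "mat_trace A = mat_trace (P * (B * Q))"
    using wit by (metis assoc_mult_mat)
  also have "\<dots> = mat_trace (B * Q * P)"
    using wit by (intro mat_trace_comm[of _ n n]) auto
  also have "B * Q * P = B"
    using wit by (metis assoc_mult_mat right_mult_one_mat)
  finally show ?thesis .
qed

text \<open>
  A Schur form \<open>B\<close> of \<open>A\<close> is triangular, so the trace of its square is the sum of the squared
  eigenvalues; each eigenvalue \<open>e\<close> is \<open>0\<close> or \<open>c\<close> and satisfies \<open>e\<^sup>2 = c e\<close> in both cases.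
\<close>

lemma trace_square_eq_trace:
  fixes A :: "complex mat"
  assumes A: "A \<in> carrier_mat n n"
    and ev: "\<And>e. eigenvalue A e \<Longrightarrow> e \<noteq> 0 \<Longrightarrow> e = c"
  shows "mat_trace (A * A) = c * mat_trace A"
proof -
  obtain es where es: "char_poly A = (\<Prod>e\<leftarrow>es. [:- e, 1:])"
    using char_poly_factorized[OF A] by auto
  obtain B P Q where "schur_decomposition A es = (B, P, Q)"
    by (cases "schur_decomposition A es")
  from schur_decomposition[OF A es this]
  have sim: "similar_mat_wit A B P Q" and ut: "upper_triangular B" and diag: "diag_mat B = es"
    by auto
  note wit = similar_mat_witD2[OF A sim]
  from wit have B: "B \<in> carrier_mat n n" by auto
  have entry: "B $$ (i, i) * B $$ (i, i) = c * B $$ (i, i)" if "i < n" for i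
  proof -
    have "B $$ (i, i) \<in> set es"
      using that B unfolding diag[symmetric] diag_mat_def by auto
    then have "eigenvalue A (B $$ (i, i))"
      unfolding eigenvalue_root_char_poly[OF A] es poly_prod_list
      by (auto simp: prod_list_zero_iff)
    with ev show ?thesis by auto
  qed
  have sim2: "similar_mat_wit (A * A) (B * B) P Q"
  proof -
    have "similar_mat_wit (A ^\<^sub>m 2) (B ^\<^sub>m 2) P Q"
      by (rule similar_mat_wit_pow[OF sim])
    then show ?thesis using A B by (simp add: numeral_2_eq_2)
  qed
  have "mat_trace (A * A) = mat_trace (B * B)"
    using mat_trace_similar[OF sim2, of n] A by auto
  also have "\<dots> = (\<Sum>i<n. \<Sum>j<n. if j = i then c * B $$ (i, i) else 0)"
    unfolding mat_trace_mult[OF B B]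
  proof (intro sum.cong refl)
    fix i j assume "i \<in> {..<n}" "j \<in> {..<n}"
    then show "B $$ (i, j) * B $$ (j, i) = (if j = i then c * B $$ (i, i) else 0)"
      using ut B entry[of i] upper_triangularD[OF ut, of i j] upper_triangularD[OF ut, of j i]
      by (cases i j rule: linorder_cases) auto
  qed
  also have "\<dots> = c * mat_trace B"
    using B by (simp add: mat_trace_def sum_distrib_left)
  also have "mat_trace B = mat_trace A"
    using mat_trace_similar[OF sim A] by simp
  finally show ?thesis .
qed

section \<open>The bound for equiangular tight frames\<close>

lemma cmod_square_eq_mult_cnj: "(complex_of_real (cmod z))\<^sup>2 = z * cnj z"
  using complex_norm_square[of z] by simp

lemma sum_sum_mult_eq_square:
  fixes f :: "'b \<Rightarrow> 'a::comm_semiring_1"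
  shows "(\<Sum>i\<in>A. \<Sum>j\<in>A. c * (f i * f j)) = c * (\<Sum>i\<in>A. f i)\<^sup>2"
  by (simp only: power2_eq_square sum_product) (simp only: sum_distrib_left)

text \<open>
  Both sides expand the squared Hilbert-Schmidt norm of \<open>\<Sum>\<^sub>i y\<^sub>i P\<^sub>i\<close> with \<open>P\<^sub>i = f\<^sub>i f\<^sub>i\<^sup>*\<close>: entry by
  entry on the left, and by \<open>\<langle>P\<^sub>i, P\<^sub>j\<rangle> = \<bar>\<langle>f\<^sub>i, f\<^sub>j\<rangle>\<bar>\<^sup>2\<close> on the right.
\<close>

lemma sum_norm_square_eq_gram:
  fixes f :: "nat \<Rightarrow> nat \<Rightarrow> complex" and y :: "nat \<Rightarrow> real"
  shows "(\<Sum>m<d. \<Sum>l<d. (cmod (\<Sum>i<n. y i * f i m * cnj (f i l)))\<^sup>2) =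
    (\<Sum>i<n. \<Sum>j<n. y i * y j * (cmod (\<Sum>m<d. f i m * cnj (f j m)))\<^sup>2)"
proof -
  have "complex_of_real (\<Sum>m<d. \<Sum>l<d. (cmod (\<Sum>i<n. y i * f i m * cnj (f i l)))\<^sup>2) =
      (\<Sum>m<d. \<Sum>l<d. \<Sum>i<n. \<Sum>j<n. y i * f i m * cnj (f i l) * (y j * cnj (f j m) * f j l))"
    by (simp add: cmod_square_eq_mult_cnj flip: sum_product)
  also have "\<dots> = (\<Sum>i<n. \<Sum>j<n. \<Sum>m<d. \<Sum>l<d.
      y i * f i m * cnj (f i l) * (y j * cnj (f j m) * f j l))"
    by (simp only: sum.swap[of _ "{..<n}" "{..<d}"])
  also have "\<dots> = (\<Sum>i<n. \<Sum>j<n. y i * y j * ((\<Sum>m<d. f i m * cnj (f j m)) *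
      (\<Sum>l<d. cnj (f i l) * f j l)))"
    by (simp only: sum_product) (simp only: sum_distrib_left mult_ac of_real_mult)
  also have "\<dots> = complex_of_real
      (\<Sum>i<n. \<Sum>j<n. y i * y j * (cmod (\<Sum>m<d. f i m * cnj (f j m)))\<^sup>2)"
    by (simp add: cmod_square_eq_mult_cnj)
  finally show ?thesis using of_real_eq_iff by blast
qed

lemma sum_equiangular_form:
  fixes y :: "nat \<Rightarrow> real"
  assumes "\<And>i. i < n \<Longrightarrow> G i i = 1"
    and "\<And>i j. i < n \<Longrightarrow> j < n \<Longrightarrow> i \<noteq> j \<Longrightarrow> G i j = g"
  shows "(\<Sum>i<n. \<Sum>j<n. y i * y j * G i j) = (1 - g) * (\<Sum>i<n. (y i)\<^sup>2) + g * (\<Sum>i<n. y i)\<^sup>2"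
proof -
  have "(\<Sum>i<n. \<Sum>j<n. y i * y j * G i j) =
      (\<Sum>i<n. \<Sum>j<n. g * (y i * y j) + (if j = i then (1 - g) * (y i)\<^sup>2 else 0))"
    using assms by (intro sum.cong refl) (auto simp: power2_eq_square algebra_simps)
  also have "\<dots> = g * (\<Sum>i<n. y i)\<^sup>2 + (1 - g) * (\<Sum>i<n. (y i)\<^sup>2)"
    by (simp only: sum.distrib sum_sum_mult_eq_square) (simp add: sum_distrib_left)
  finally show ?thesis by simp
qed

text \<open>
  Evaluating \<open>tr G\<^sup>2 = (n/d) tr G\<close> on the equiangular Gram matrix gives equality in the Welch
  bound, which determines \<open>\<alpha>\<close>. The diagonal entries of the frame operator \<open>S\<close> all equal \<open>n/d\<close>
  because \<open>tr S = n\<close> and \<open>tr S\<^sup>2 = tr G\<^sup>2 = n\<^sup>2/d\<close>: the diagonal entries have mean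
  \<open>n/d\<close> and mean square at most \<open>(n/d)\<^sup>2\<close>, so their variance is \<open>0\<close>.
\<close>

lemma etf_welch_and_tight:
  fixes u :: "nat \<Rightarrow> complex vec"
  assumes etf: "equiangular_tight_frame d n u" and n: "2 \<le> n"
  obtains \<alpha> :: real where
    "0 < d" "\<alpha>\<^sup>2 \<le> 1"
    "real n ^ 2 / real d = real n + real n * (real n - 1) * \<alpha>\<^sup>2"
    "\<And>i. i < n \<Longrightarrow> (\<Sum>m<d. (cmod (u i $ m))\<^sup>2) = 1"
    "\<And>i j. i < n \<Longrightarrow> j < n \<Longrightarrow> i \<noteq> j \<Longrightarrow> (cmod (\<Sum>m<d. u i $ m * cnj (u j $ m)))\<^sup>2 = \<alpha>\<^sup>2"
    "\<And>m. m < d \<Longrightarrow> (\<Sum>i<n. (cmod (u i $ m))\<^sup>2) = real n / real d"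
proof -
  from etf obtain \<alpha> :: real where
    car: "\<And>i. i < n \<Longrightarrow> u i \<in> carrier_vec d" and unit: "\<And>i. i < n \<Longrightarrow> u i \<bullet>c u i = 1"
    and ev: "\<And>e. eigenvalue (gram_matrix n u) e \<Longrightarrow> e \<noteq> 0 \<Longrightarrow> e = of_nat n / of_nat d"
    and \<alpha>: "0 \<le> \<alpha>" "\<alpha> \<le> 1"
    and eq: "\<And>i j. i < n \<Longrightarrow> j < n \<Longrightarrow> i \<noteq> j \<Longrightarrow> cmod (u i \<bullet>c u j) = \<alpha>"
    unfolding equiangular_tight_frame_def by blast
  define c :: real where "c = real n / real d"
  have ip: "u i \<bullet>c u j = (\<Sum>m<d. u i $ m * cnj (u j $ m))" if "i < n" "j < n" for i j
    using car[OF that(1)] car[OF that(2)] by (simp add: scalar_prod_def lessThan_atLeast0)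
  have d: "0 < d"
    using ip[of 0 0] unit[of 0] n by (intro Nat.gr0I) simp
  have norm1: "(\<Sum>m<d. (cmod (u i $ m))\<^sup>2) = 1" if "i < n" for i
  proof -
    have "complex_of_real (\<Sum>m<d. (cmod (u i $ m))\<^sup>2) = 1"
      using ip[OF that that] unit[OF that] by (simp add: cmod_square_eq_mult_cnj)
    then show ?thesis using of_real_eq_1_iff by blast
  qed
  have off: "(cmod (\<Sum>m<d. u i $ m * cnj (u j $ m)))\<^sup>2 = \<alpha>\<^sup>2" if "i < n" "j < n" "i \<noteq> j" for i j
    using eq[OF that] ip[OF that(1,2)] by simp
  have diag: "(cmod (\<Sum>m<d. u i $ m * cnj (u i $ m)))\<^sup>2 = 1" if "i < n" for i
    using ip[OF that that] unit[OF that] by simp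
  define G where "G = gram_matrix n u"
  have G: "G \<in> carrier_mat n n" unfolding G_def gram_matrix_def by simp
  have trG: "mat_trace G = of_nat n"
    unfolding mat_trace_def G_def gram_matrix_def using unit by simp
  have "mat_trace (G * G) = c * mat_trace G"
    using ev by (intro trace_square_eq_trace[OF G]) (simp add: G_def c_def)
  moreover have "mat_trace (G * G) =
      complex_of_real (\<Sum>i<n. \<Sum>j<n. (cmod (\<Sum>m<d. u i $ m * cnj (u j $ m)))\<^sup>2)"
    unfolding mat_trace_mult[OF G G] of_real_sum
  proof (intro sum.cong refl)
    fix i j assume ij: "i \<in> {..<n}" "j \<in> {..<n}"
    have "G $$ (i, j) * G $$ (j, i) = (\<Sum>m<d. u i $ m * cnj (u j $ m)) * (\<Sum>m<d. u j $ m * cnj (u i $ m))"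
      using ij ip unfolding G_def gram_matrix_def by simp
    also have "(\<Sum>m<d. u j $ m * cnj (u i $ m)) = cnj (\<Sum>m<d. u i $ m * cnj (u j $ m))"
      by (simp add: mult.commute)
    finally show "G $$ (i, j) * G $$ (j, i) =
        complex_of_real ((cmod (\<Sum>m<d. u i $ m * cnj (u j $ m)))\<^sup>2)"
      by (simp only: complex_norm_square)
  qed
  ultimately have "complex_of_real (\<Sum>i<n. \<Sum>j<n. (cmod (\<Sum>m<d. u i $ m * cnj (u j $ m)))\<^sup>2) =
      complex_of_real (c * real n)"
    using trG by simp
  then have gram2: "(\<Sum>i<n. \<Sum>j<n. (cmod (\<Sum>m<d. u i $ m * cnj (u j $ m)))\<^sup>2) = c * real n"
    using of_real_eq_iff by blast
  have welch: "real n ^ 2 / real d = real n + real n * (real n - 1) * \<alpha>\<^sup>2"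
    using gram2 sum_equiangular_form[where y = "\<lambda>_. 1" and n = n and g = "\<alpha>\<^sup>2" and
        G = "\<lambda>i j. (cmod (\<Sum>m<d. u i $ m * cnj (u j $ m)))\<^sup>2", OF diag off]
    by (simp add: c_def power2_eq_square algebra_simps)
  define S where "S = (\<lambda>m l. \<Sum>i<n. u i $ m * cnj (u i $ l))"
  have S2: "(\<Sum>m<d. \<Sum>l<d. (cmod (S m l))\<^sup>2) = c * real n"
    using sum_norm_square_eq_gram[where y = "\<lambda>_. 1" and f = "\<lambda>i m. u i $ m" and n = n and d = d] gram2
    by (simp add: S_def)
  have Sdiag: "S m m = of_real (\<Sum>i<n. (cmod (u i $ m))\<^sup>2)" for m
    by (simp add: S_def cmod_square_eq_mult_cnj)
  define t where "t = (\<lambda>m. \<Sum>i<n. (cmod (u i $ m))\<^sup>2)"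
  have trS: "(\<Sum>m<d. t m) = real n"
    unfolding t_def by (subst sum.swap) (simp add: norm1)
  have "(\<Sum>m<d. (t m)\<^sup>2) \<le> (\<Sum>m<d. \<Sum>l<d. (cmod (S m l))\<^sup>2)"
  proof (rule sum_mono)
    fix m assume "m \<in> {..<d}"
    moreover have "(t m)\<^sup>2 = (cmod (S m m))\<^sup>2" unfolding Sdiag t_def by (simp only: norm_of_real power2_abs)
    ultimately show "(t m)\<^sup>2 \<le> (\<Sum>l<d. (cmod (S m l))\<^sup>2)"
      using member_le_sum[of m "{..<d}" "\<lambda>l. (cmod (S m l))\<^sup>2"] by simp
  qed
  then have "(\<Sum>m<d. (t m - c)\<^sup>2) \<le> 0"
    using S2 trS d by (simp add: power2_diff sum.distrib sum_subtractf flip: sum_distrib_left sum_distrib_right)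
      (simp add: c_def field_simps power2_eq_square)
  then have "(\<Sum>m<d. (t m - c)\<^sup>2) = 0" by (simp add: order_antisym sum_nonneg)
  then have "t m = c" if "m < d" for m
    using that by (simp add: sum_nonneg_eq_0_iff)
  then have tight: "(\<Sum>i<n. (cmod (u i $ m))\<^sup>2) = real n / real d" if "m < d" for m
    using that by (simp add: t_def c_def)
  show ?thesis
    using \<alpha> by (intro that[OF d _ welch norm1 off tight]) (auto simp: power_le_one)
qed

text \<open>
  The left side is \<open>x\<^sup>T R x\<close>. In the notation of the proof, \<open>x'\<close> is the centred part of \<open>x\<close>,
  \<open>y\<close> lists the products of its diagonal matrix with the projections \<open>P\<^sub>i\<close>, and \<open>z\<close> is the
  diagonal of \<open>\<Sum>\<^sub>i y\<^sub>i P\<^sub>i\<close>. Since the \<open>y\<^sub>i\<close> sum to \<open>0\<close>, the squared norm of that matrix is \<open>(1 - \<alpha>\<^sup>2) Y\<close>,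
  and \<open>Y = \<langle>x', z\<rangle>\<close> lets Cauchy-Schwarz bound \<open>Y\<close> by \<open>(1 - \<alpha>\<^sup>2) X\<close>.
\<close>

lemma etf_quadratic_form_le:
  fixes u :: "nat \<Rightarrow> complex vec" and x :: "nat \<Rightarrow> real"
  assumes etf: "equiangular_tight_frame d n u" and n: "2 \<le> n"
  shows "(\<Sum>i<n. (\<Sum>m<d. x m * (cmod (u i $ m))\<^sup>2)\<^sup>2) \<le>
    (1 - 1 / real d) / (1 - 1 / real n) * (\<Sum>m<d. (x m)\<^sup>2) +
    (real n / real d - 1) / (real d * (1 - 1 / real n)) * (\<Sum>m<d. x m)\<^sup>2"
proof (rule etf_welch_and_tight[OF etf n])
  fix \<alpha> :: real
  assume d: "0 < d" and \<alpha>: "\<alpha>\<^sup>2 \<le> 1"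
    and welch: "real n ^ 2 / real d = real n + real n * (real n - 1) * \<alpha>\<^sup>2"
    and norm1: "\<And>i. i < n \<Longrightarrow> (\<Sum>m<d. (cmod (u i $ m))\<^sup>2) = 1"
    and off: "\<And>i j. i < n \<Longrightarrow> j < n \<Longrightarrow> i \<noteq> j \<Longrightarrow>
      (cmod (\<Sum>m<d. u i $ m * cnj (u j $ m)))\<^sup>2 = \<alpha>\<^sup>2"
    and tight: "\<And>m. m < d \<Longrightarrow> (\<Sum>i<n. (cmod (u i $ m))\<^sup>2) = real n / real d"
  define a where "a = 1 - \<alpha>\<^sup>2"
  define t where "t = (\<Sum>m<d. x m) / real d"
  define x' where "x' m = x m - t" for m
  define p where "p i m = (cmod (u i $ m))\<^sup>2" for i m
  define q where "q i = (\<Sum>m<d. x m * p i m)" for i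
  define y where "y i = (\<Sum>m<d. x' m * p i m)" for i
  define z where "z m = (\<Sum>i<n. y i * p i m)" for m
  define X Y where "X = (\<Sum>m<d. (x' m)\<^sup>2)" and "Y = (\<Sum>i<n. (y i)\<^sup>2)"
  have sx': "(\<Sum>m<d. x' m) = 0"
    using d by (simp add: x'_def t_def sum_subtractf)
  have q_y: "q i = y i + t" if "i < n" for i
    using norm1[OF that]
    by (simp add: y_def q_def x'_def p_def left_diff_distrib sum_subtractf flip: sum_distrib_left)
  have sy: "(\<Sum>i<n. y i) = 0"
  proof -
    have "(\<Sum>i<n. y i) = (\<Sum>m<d. x' m * (\<Sum>i<n. p i m))"
      unfolding y_def by (subst sum.swap) (simp add: sum_distrib_left)
    also have "\<dots> = (\<Sum>m<d. x' m * (real n / real d))"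
      using tight by (simp add: p_def)
    also have "\<dots> = 0" by (simp only: sum_distrib_right[symmetric] sx')
    finally show ?thesis .
  qed
  have diag: "(cmod (\<Sum>m<d. u i $ m * cnj (u i $ m)))\<^sup>2 = 1" if "i < n" for i
  proof -
    have "(\<Sum>m<d. u i $ m * cnj (u i $ m)) = complex_of_real (\<Sum>m<d. (cmod (u i $ m))\<^sup>2)"
      by (simp add: cmod_square_eq_mult_cnj)
    then show ?thesis using norm1[OF that] by simp
  qed
  \<comment> \<open>Dropping the off-diagonal entries of \<open>\<Sum>\<^sub>i y\<^sub>i P\<^sub>i\<close> can only decrease its norm.\<close>
  have "(\<Sum>m<d. (z m)\<^sup>2) \<le> (\<Sum>m<d. \<Sum>l<d. (cmod (\<Sum>i<n. y i * u i $ m * cnj (u i $ l)))\<^sup>2)"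
  proof (rule sum_mono)
    fix m assume m: "m \<in> {..<d}"
    have "(\<Sum>i<n. y i * u i $ m * cnj (u i $ m)) = complex_of_real (z m)"
      by (simp add: z_def p_def cmod_square_eq_mult_cnj mult.assoc)
    then have "(z m)\<^sup>2 = (cmod (\<Sum>i<n. y i * u i $ m * cnj (u i $ m)))\<^sup>2" by simp
    also have "\<dots> \<le> (\<Sum>l<d. (cmod (\<Sum>i<n. y i * u i $ m * cnj (u i $ l)))\<^sup>2)"
      by (rule member_le_sum[OF m]) auto
    finally show "(z m)\<^sup>2 \<le> (\<Sum>l<d. (cmod (\<Sum>i<n. y i * u i $ m * cnj (u i $ l)))\<^sup>2)" .
  qed
  also have "\<dots> = a * Y"
    unfolding sum_norm_square_eq_gram[where f = "\<lambda>i m. u i $ m"]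
    using sum_equiangular_form[where y = y and n = n and g = "\<alpha>\<^sup>2" and
        G = "\<lambda>i j. (cmod (\<Sum>m<d. u i $ m * cnj (u j $ m)))\<^sup>2", OF diag off] sy
    by (simp add: a_def Y_def)
  finally have z_le: "(\<Sum>m<d. (z m)\<^sup>2) \<le> a * Y" .
  have xz: "(\<Sum>m<d. x' m * z m) = Y"
  proof -
    have "(\<Sum>m<d. x' m * z m) = (\<Sum>i<n. y i * (\<Sum>m<d. x' m * p i m))"
      unfolding z_def sum_distrib_left by (subst sum.swap) (simp add: mult_ac)
    then show ?thesis by (simp add: Y_def y_def[symmetric] power2_eq_square)
  qed
  have X0: "0 \<le> X" and Y0: "0 \<le> Y" unfolding X_def Y_def by (auto intro: sum_nonneg)
  have "Y\<^sup>2 \<le> X * (\<Sum>m<d. (z m)\<^sup>2)"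
    using Cauchy_Schwarz_ineq_sum[of x' z "{..<d}"] xz by (simp add: X_def)
  also have "\<dots> \<le> X * (a * Y)" by (rule mult_left_mono[OF z_le X0])
  finally have "Y * Y \<le> (a * X) * Y" by (simp add: power2_eq_square mult_ac)
  moreover have "0 \<le> a * X" using \<alpha> X0 by (simp add: a_def)
  ultimately have Y_le: "Y \<le> a * X" using Y0
    by (cases "Y = 0") (auto simp: mult_le_cancel_right)
  have sumq: "(\<Sum>i<n. (q i)\<^sup>2) = Y + real n * t\<^sup>2"
  proof -
    have "(\<Sum>i<n. (q i)\<^sup>2) = (\<Sum>i<n. (y i)\<^sup>2 + 2 * t * y i + t\<^sup>2)"
      by (intro sum.cong refl) (simp add: q_y power2_eq_square algebra_simps)
    then show ?thesis using sy by (simp add: sum.distrib Y_def flip: sum_distrib_left)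
  qed
  have td: "(\<Sum>m<d. x m) = t * real d" using d by (simp add: t_def)
  have X: "X = (\<Sum>m<d. (x m)\<^sup>2) - real d * t\<^sup>2"
  proof -
    have "X = (\<Sum>m<d. (x m)\<^sup>2 - 2 * t * x m + t\<^sup>2)"
      unfolding X_def x'_def by (intro sum.cong refl) (simp add: power2_eq_square algebra_simps)
    then show ?thesis using td
      by (simp add: sum.distrib sum_subtractf power2_eq_square flip: sum_distrib_left)
  qed
  have a_eq: "a = (1 - 1 / real d) / (1 - 1 / real n)"
  proof -
    have "a * (1 - 1 / real n) * real n = (1 - 1 / real d) * real n"
      using welch n d by (simp add: a_def field_simps power2_eq_square)
    then have "a * (1 - 1 / real n) = 1 - 1 / real d"
      using n by (simp only: mult_cancel_right) simp
    moreover have "1 - 1 / real n \<noteq> 0" using n by simp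
    ultimately show ?thesis by (intro eq_divide_imp)
  qed
  have c_eq: "(real n / real d - 1) / (real d * (1 - 1 / real n)) * (real d)\<^sup>2 = real n - a * real d"
    unfolding a_eq using n d by (simp add: divide_simps power2_eq_square) (simp add: algebra_simps)
  have "(\<Sum>i<n. (q i)\<^sup>2) \<le> a * ((\<Sum>m<d. (x m)\<^sup>2) - real d * t\<^sup>2) + real n * t\<^sup>2"
    using sumq Y_le X by simp
  also have "\<dots> = a * (\<Sum>m<d. (x m)\<^sup>2) + (real n - a * real d) * t\<^sup>2"
    by (simp add: algebra_simps)
  also have "\<dots> = a * (\<Sum>m<d. (x m)\<^sup>2) +
      (real n / real d - 1) / (real d * (1 - 1 / real n)) * (\<Sum>m<d. x m)\<^sup>2"
    unfolding c_eq[symmetric] td by (simp add: power_mult_distrib mult_ac)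
  finally show ?thesis unfolding q_def p_def a_eq .
qed

lemma etf_loewner_bound:
  assumes etf: "equiangular_tight_frame d n u" and n: "2 \<le> n"
  shows "loewner_le d (R_matrix d n u) (bound_matrix d n)"
proof -
  define a where "a = (1 - 1 / real d) / (1 - 1 / real n)"
  define c where "c = (real n / real d - 1) / (real d * (1 - 1 / real n))"
  define p where "p i m = (cmod (u i $ m))\<^sup>2" for i m
  let ?D = "bound_matrix d n - R_matrix d n u"
  have D: "?D = mat d d (\<lambda>(m, l). (if m = l then a else 0) + c - (\<Sum>i<n. p i m * p i l))"
    by (rule eq_matI) (auto simp: bound_matrix_def R_matrix_def a_def c_def p_def)
  have "0 \<le> x \<bullet> (?D *\<^sub>v x)" if x: "x \<in> carrier_vec d" for x
  proof -
    have "x \<bullet> (?D *\<^sub>v x) = (\<Sum>m<d. x $ m * (\<Sum>l<d.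
        ((if m = l then a else 0) + c - (\<Sum>i<n. p i m * p i l)) * x $ l))"
      unfolding D using x by (simp add: scalar_prod_def lessThan_atLeast0)
    also have "\<dots> = (\<Sum>m<d. \<Sum>l<d. (if l = m then a * (x $ m)\<^sup>2 else 0) + c * (x $ m * x $ l)
        - (\<Sum>i<n. (x $ m * p i m) * (x $ l * p i l)))"
      unfolding sum_distrib_left
      by (intro sum.cong refl) (auto simp: power2_eq_square algebra_simps sum_distrib_left)
    also have "\<dots> = a * (\<Sum>m<d. (x $ m)\<^sup>2) + c * (\<Sum>m<d. x $ m)\<^sup>2
        - (\<Sum>m<d. \<Sum>l<d. \<Sum>i<n. (x $ m * p i m) * (x $ l * p i l))"
      by (simp only: sum.distrib sum_subtractf sum_sum_mult_eq_square) (simp add: sum_distrib_left)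
    also have "(\<Sum>m<d. \<Sum>l<d. \<Sum>i<n. (x $ m * p i m) * (x $ l * p i l)) =
        (\<Sum>i<n. (\<Sum>m<d. x $ m * p i m)\<^sup>2)"
      by (simp only: sum.swap[of _ "{..<n}" "{..<d}"] power2_eq_square sum_product)
    finally show ?thesis
      using etf_quadratic_form_le[OF etf n, of "\<lambda>m. x $ m"] by (simp add: a_def c_def p_def)
  qed
  moreover have "transpose_mat ?D = ?D"
    unfolding D by (rule eq_matI) (auto simp: mult.commute)
  ultimately show ?thesis
    unfolding loewner_le_def positive_semidefinite_def
    by (auto simp: bound_matrix_def R_matrix_def)
qed

section \<open>The kernel attached to an incidence matrix\<close>

lemma kernel_dim_eq_param:
  fixes A P :: "'a::field mat"
  assumes A: "A \<in> carrier_mat nr nc" and P: "P \<in> carrier_mat nc n"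
    and inj: "\<And>y. y \<in> carrier_vec n \<Longrightarrow> P *\<^sub>v y = 0\<^sub>v nc \<Longrightarrow> y = 0\<^sub>v n"
    and range: "mat_kernel A = (\<lambda>y. P *\<^sub>v y) ` carrier_vec n"
  shows "kernel_dim A = n"
proof -
  interpret K: kernel nr nc A by (unfold_locales, rule A)
  interpret V: vec_space "TYPE('a)" n .
  have mem: "P *\<^sub>v y \<in> mat_kernel A" if "y \<in> carrier_vec n" for y
    using that range by auto
  interpret L: linear_map class_ring V.V K.VK "\<lambda>y. P *\<^sub>v y"
  proof (intro linear_map.intro mod_hom.intro mod_hom_axioms.intro)
    show "vectorspace class_ring V.V" by (rule V.vectorspace_axioms)
    show "vectorspace class_ring K.VK" by (rule K.Ker.vectorspace_axioms)
    show "Module.module class_ring V.V" by (rule V.module_axioms)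
    show "Module.module class_ring K.VK" by (rule K.Ker.module_axioms)
    show "(\<lambda>y. P *\<^sub>v y) \<in> module_hom class_ring V.V K.VK"
      using mem P by (auto simp: module_hom_def module_vec_simps mult_add_distrib_mat_vec
          mult_mat_vec class_ring_simps)
  qed
  have "inj_on (\<lambda>y. P *\<^sub>v y) (carrier_vec n)"
  proof (rule inj_onI)
    fix y z assume y: "y \<in> carrier_vec n" and z: "z \<in> carrier_vec n" and "P *\<^sub>v y = P *\<^sub>v z"
    then have "P *\<^sub>v (y - z) = 0\<^sub>v nc"
      using P by (simp add: mult_minus_distrib_mat_vec)
    then have "y - z = 0\<^sub>v n" using inj y z by simp
    then have "y $ i - z $ i = 0" if "i < n" for i
      using that y z by (metis carrier_vecD index_minus_vec(1) index_zero_vec(1))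
    then show "y = z" using y z by (intro eq_vecI) auto
  qed
  then have "V.dim = K.dim"
    using L.dim_eq[OF V.fin_dim] range by (simp add: module_vec_simps)
  then show ?thesis using V.dim_is_n by simp
qed

text \<open>
  Here \<open>P = M\<^sup>T\<close>, and \<open>pair\<close> says \<open>P\<^sup>T P = (\<rho> - 1) I + J\<close>. On \<open>P y\<close> the matrix acts as
  \<open>(a - g (\<rho> - 1)) P y\<close> plus \<open>c \<rho> - g k\<close> times the sum of the \<open>y\<^sub>j\<close> in every coordinate, and the
  choice of \<open>a\<close> and \<open>c\<close> makes both coefficients vanish.
\<close>

lemma incidence_kernel_dim:
  fixes I :: "nat \<Rightarrow> nat \<Rightarrow> real" and a c g \<rho> k :: real
  assumes point: "\<And>j. j < v \<Longrightarrow> (\<Sum>m<b. I j m) = \<rho>"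
    and block: "\<And>m. m < b \<Longrightarrow> (\<Sum>j<v. I j m) = k"
    and pair: "\<And>i j. i < v \<Longrightarrow> j < v \<Longrightarrow> (\<Sum>m<b. I i m * I j m) = (if i = j then \<rho> else 1)"
    and \<rho>: "1 < \<rho>" and k: "0 < k" and g: "0 < g"
    and a: "a = g * (\<rho> - 1)" and c: "c = g * (k / \<rho>)"
  shows "kernel_dim (mat b b (\<lambda>(m, l). (if m = l then a else 0) + c - g * (\<Sum>j<v. I j m * I j l))) = v"
    (is "kernel_dim ?A = v")
proof (rule kernel_dim_eq_param)
  let ?P = "mat b v (\<lambda>(m, j). I j m)"
  show A: "?A \<in> carrier_mat b b" and P: "?P \<in> carrier_mat b v" by auto
  have P_nth: "(?P *\<^sub>v y) $ m = (\<Sum>j<v. I j m * y $ j)" if "y \<in> carrier_vec v" "m < b" for y m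
    using that by (simp add: scalar_prod_def lessThan_atLeast0)
  have A_nth: "(?A *\<^sub>v x) $ m = a * x $ m + c * (\<Sum>l<b. x $ l) - g * (\<Sum>j<v. I j m * (\<Sum>l<b. I j l * x $ l))"
    if "x \<in> carrier_vec b" "m < b" for x m
  proof -
    have "(?A *\<^sub>v x) $ m = (\<Sum>l<b. ((if m = l then a else 0) + c - g * (\<Sum>j<v. I j m * I j l)) * x $ l)"
      using that by (simp add: scalar_prod_def lessThan_atLeast0)
    also have "\<dots> = (\<Sum>l<b. (if l = m then a * x $ m else 0) + c * x $ l - (\<Sum>j<v. g * (I j m * (I j l * x $ l))))"
      by (intro sum.cong refl) (auto simp: algebra_simps sum_distrib_left sum_distrib_right)
    also have "\<dots> = a * x $ m + c * (\<Sum>l<b. x $ l) - (\<Sum>l<b. \<Sum>j<v. g * (I j m * (I j l * x $ l)))"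
      using that by (simp add: sum.distrib sum_subtractf sum_distrib_left)
    also have "(\<Sum>l<b. \<Sum>j<v. g * (I j m * (I j l * x $ l))) = g * (\<Sum>j<v. I j m * (\<Sum>l<b. I j l * x $ l))"
      by (subst sum.swap) (simp add: sum_distrib_left)
    finally show ?thesis .
  qed
  have sumP: "(\<Sum>l<b. \<Sum>j<v. I j l * y $ j) = \<rho> * (\<Sum>j<v. y $ j)" for y
    by (subst sum.swap) (simp add: point sum_distrib_left flip: sum_distrib_right)
  have gramP: "(\<Sum>l<b. I i l * (\<Sum>j<v. I j l * y $ j)) = (\<rho> - 1) * y $ i + (\<Sum>j<v. y $ j)"
    if "i < v" for i y
  proof -
    have "(\<Sum>l<b. I i l * (\<Sum>j<v. I j l * y $ j)) = (\<Sum>j<v. (\<Sum>l<b. I i l * I j l) * y $ j)"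
      unfolding sum_distrib_left sum_distrib_right by (subst sum.swap) (simp add: mult.assoc)
    also have "\<dots> = (\<Sum>j<v. (if j = i then (\<rho> - 1) * y $ i else 0) + y $ j)"
      using that by (intro sum.cong refl) (auto simp: pair algebra_simps)
    finally show ?thesis using that by (simp add: sum.distrib)
  qed
  show "y = 0\<^sub>v v" if y: "y \<in> carrier_vec v" and 0: "?P *\<^sub>v y = 0\<^sub>v b" for y
  proof -
    have z: "(\<Sum>j<v. I j l * y $ j) = 0" if "l < b" for l
      using P_nth[OF y that] 0 that by simp
    have "(\<Sum>j<v. y $ j) = 0" using sumP[of y] z \<rho> by simp
    then have "y $ i = 0" if "i < v" for i
      using gramP[OF that, of y] z \<rho> by simp
    then show ?thesis using y by (intro eq_vecI) auto
  qed
  show "mat_kernel ?A = (\<lambda>y. ?P *\<^sub>v y) ` carrier_vec v"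
  proof (intro equalityI subsetI)
    fix x assume "x \<in> mat_kernel ?A"
    then have x: "x \<in> carrier_vec b" and 0: "?A *\<^sub>v x = 0\<^sub>v b"
      using mat_kernelD[OF A] by auto
    define z where "z j = (\<Sum>l<b. I j l * x $ l)" for j
    \<comment> \<open>Solve \<open>a x = g P (P\<^sup>T x) - c J x\<close> for \<open>x\<close>, using \<open>J x = P (s / k, ..., s / k)\<close> with \<open>s\<close> the sum
      of the coordinates of \<open>x\<close>.\<close>
    define y where "y = vec v (\<lambda>j. (g * z j - c * (\<Sum>l<b. x $ l) / k) / a)"
    have "a \<noteq> 0" using a g \<rho> by simp
    have "x = ?P *\<^sub>v y"
    proof (rule eq_vecI)
      fix m assume "m < dim_vec (?P *\<^sub>v y)"
      then have m: "m < b" by simp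
      have "a * (?P *\<^sub>v y) $ m = (\<Sum>j<v. a * (I j m * y $ j))"
        using P_nth[of y m] m by (simp add: y_def sum_distrib_left)
      also have "\<dots> = (\<Sum>j<v. g * (I j m * z j) - I j m * (c * (\<Sum>l<b. x $ l) / k))"
      proof (intro sum.cong refl)
        fix j assume "j \<in> {..<v}"
        then have "a * y $ j = g * z j - c * (\<Sum>l<b. x $ l) / k"
          using \<open>a \<noteq> 0\<close> by (simp add: y_def)
        then show "a * (I j m * y $ j) = g * (I j m * z j) - I j m * (c * (\<Sum>l<b. x $ l) / k)"
          by (simp add: mult.left_commute[of a] right_diff_distrib mult.left_commute)
      qed
      also have "\<dots> = g * (\<Sum>j<v. I j m * z j) - c * (\<Sum>l<b. x $ l)"
        using k by (simp only: sum_subtractf sum_distrib_left[symmetric] sum_distrib_right[symmetric]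
            block[OF m]) simp
      also have "\<dots> = a * x $ m"
        using A_nth[OF x m] 0 m by (simp add: z_def)
      finally show "x $ m = (?P *\<^sub>v y) $ m" using \<open>a \<noteq> 0\<close> by simp
    qed (use x in simp)
    then show "x \<in> (\<lambda>y. ?P *\<^sub>v y) ` carrier_vec v" by (auto simp: y_def)
  next
    fix x assume "x \<in> (\<lambda>y. ?P *\<^sub>v y) ` carrier_vec v"
    then obtain y where y: "y \<in> carrier_vec v" and x: "x = ?P *\<^sub>v y" by auto
    have xc: "x \<in> carrier_vec b" unfolding x by (rule mult_mat_vec_carrier[OF P y])
    have x_nth: "x $ m = (\<Sum>j<v. I j m * y $ j)" if "m < b" for m
      using P_nth[OF y that] x by simp
    let ?Y = "\<Sum>j<v. y $ j"
    have "(?A *\<^sub>v x) $ m = 0" if m: "m < b" for m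
    proof -
      have "(\<Sum>j<v. I j m * (\<Sum>l<b. I j l * x $ l)) = (\<Sum>j<v. I j m * ((\<rho> - 1) * y $ j + ?Y))"
        by (intro sum.cong refl) (simp add: x_nth gramP)
      also have "\<dots> = (\<rho> - 1) * x $ m + k * ?Y"
        using block[OF m]
        by (simp only: distrib_left sum.distrib sum_distrib_right[symmetric])
          (simp add: x_nth[OF m] sum_distrib_left mult_ac)
      finally show ?thesis
        using A_nth[OF xc m] sumP[of y] \<rho> by (simp add: x_nth a c) (simp add: algebra_simps)
    qed
    then show "x \<in> mat_kernel ?A"
      by (intro mat_kernelI[OF A xc]) (intro eq_vecI, auto)
  qed
qed

section \<open>Counting in Steiner systems\<close>

lemma steiner_finite_blocks: "steiner_system k v S \<B> \<Longrightarrow> finite \<B>"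
  unfolding steiner_system_def by (meson finite_Pow_iff finite_subset)

lemma steiner_system_unique_block:
  assumes "steiner_system k v S \<B>" "p \<in> S" "q \<in> S" "p \<noteq> q"
  shows "\<exists>!B. B \<in> \<B> \<and> p \<in> B \<and> q \<in> B"
proof -
  have "{p, q} \<subseteq> S \<and> card {p, q} = 2" using assms(2-4) by simp
  then have "\<exists>!B. B \<in> \<B> \<and> {p, q} \<subseteq> B"
    using assms(1) unfolding steiner_system_def by presburger
  then show ?thesis by simp
qed

lemma steiner_two_points:
  assumes "steiner_system k v S \<B>" "p \<in> S" "q \<in> S" "p \<noteq> q"
  shows "card {B \<in> \<B>. p \<in> B \<and> q \<in> B} = 1"
proof -
  obtain B where B: "B \<in> \<B>" "p \<in> B" "q \<in> B"
    and uniq: "\<And>C. C \<in> \<B> \<and> p \<in> C \<and> q \<in> C \<Longrightarrow> C = B"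
    using steiner_system_unique_block[OF assms] by (elim ex1E) blast
  then have "{B \<in> \<B>. p \<in> B \<and> q \<in> B} = {B}" by blast
  then show ?thesis by simp
qed

text \<open>The blocks through \<open>p\<close>, with \<open>p\<close> removed, partition the other points.\<close>

lemma steiner_point_degree:
  assumes st: "steiner_system k v S \<B>" and p: "p \<in> S"
  shows "card {B \<in> \<B>. p \<in> B} * (k - 1) = v - 1"
proof -
  have fin: "finite S" "card S = v" and sub: "\<And>B. B \<in> \<B> \<Longrightarrow> B \<subseteq> S"
    and card: "\<And>B. B \<in> \<B> \<Longrightarrow> card B = k"
    using st unfolding steiner_system_def by auto
  let ?T = "{B \<in> \<B>. p \<in> B}"
  have uniq: "\<exists>!B. B \<in> \<B> \<and> p \<in> B \<and> q \<in> B" if "q \<in> S" "p \<noteq> q" for q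
    by (rule steiner_system_unique_block[OF st p that])
  have "S - {p} = (\<Union>B\<in>?T. B - {p})"
  proof (intro equalityI subsetI)
    fix q assume q: "q \<in> S - {p}"
    then obtain B where "B \<in> \<B>" "p \<in> B" "q \<in> B" using uniq[of q] by blast
    with q show "q \<in> (\<Union>B\<in>?T. B - {p})" by blast
  qed (use sub in blast)
  then have "v - 1 = card (\<Union>B\<in>?T. B - {p})" using fin p by (metis card_Diff_singleton)
  also have "\<dots> = (\<Sum>B\<in>?T. card (B - {p}))"
  proof (rule card_UN_disjoint)
    show "finite ?T" using steiner_finite_blocks[OF st] by simp
    show "\<forall>B\<in>?T. finite (B - {p})" using fin(1) sub by (blast intro: finite_subset)
    show "\<forall>B\<in>?T. \<forall>C\<in>?T. B \<noteq> C \<longrightarrow> (B - {p}) \<inter> (C - {p}) = {}"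
    proof (intro ballI impI equals0I)
      fix B C q assume BC: "B \<in> ?T" "C \<in> ?T" "B \<noteq> C" and q: "q \<in> (B - {p}) \<inter> (C - {p})"
      then have "q \<in> S" "p \<noteq> q" using sub by blast+
      from uniq[OF this] BC q show False by blast
    qed
  qed
  also have "\<dots> = (\<Sum>B\<in>?T. k - 1)"
    by (intro sum.cong refl) (simp add: card card_Diff_singleton)
  finally show ?thesis by simp
qed

lemma sum_of_bool_bij:
  fixes f :: "nat \<Rightarrow> 'b"
  assumes "bij_betw f {..<n} A"
  shows "(\<Sum>i<n. of_bool (P (f i)) :: real) = real (card {x \<in> A. P x})"
proof -
  have "(\<Sum>i<n. of_bool (P (f i)) :: real) = (\<Sum>x\<in>A. of_bool (P x))"
    by (rule sum.reindex_bij_betw[OF assms])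
  moreover have "finite A" using bij_betw_finite[OF assms] by simp
  ultimately show ?thesis by (simp add: Int_def)
qed

text \<open>
  With \<open>t = 1 + (1 + \<rho>) (k - 1)\<close> one has \<open>N - 1 = \<rho> t\<close>, \<open>v \<rho> - k = (\<rho> - 1) t\<close> and
  \<open>N / r - 1 = t / \<rho>\<close>, so \<open>t\<close> cancels from both coefficients.
\<close>

lemma steiner_scalars:
  fixes v k \<rho> r N :: real
  assumes k: "2 \<le> k" and \<rho>: "1 < \<rho>" and v: "v - 1 = \<rho> * (k - 1)"
    and r: "r * k = v * \<rho>" and N: "N = v * (1 + \<rho>)"
  shows "(1 - 1 / r) / (1 - 1 / N) = (1 + \<rho>) / \<rho>\<^sup>2 * (\<rho> - 1)"
    and "(N / r - 1) / (r * (1 - 1 / N)) = (1 + \<rho>) / \<rho>\<^sup>2 * (k / \<rho>)"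
proof -
  have veq: "v = 1 + \<rho> * (k - 1)" using v by simp
  have "0 < \<rho> * (k - 1)" using k \<rho> by simp
  then have vpos: "1 < v" using veq by simp
  have req: "r = v * \<rho> / k" using r k by (simp add: field_simps)
  define t where "t = 1 + (1 + \<rho>) * (k - 1)"
  have t: "0 < t" using k \<rho> by (simp add: t_def add_pos_pos)
  have "v * (1 + \<rho>) - 1 = \<rho> * t" by (simp add: veq t_def algebra_simps)
  then have 1: "1 - 1 / N = \<rho> * t / (v * (1 + \<rho>))"
    using vpos \<rho> unfolding N by (simp add: diff_divide_eq_iff)
  have "v * \<rho> - k = (\<rho> - 1) * t" by (simp add: veq t_def algebra_simps)
  then have 2: "1 - 1 / r = (\<rho> - 1) * t / (v * \<rho>)"
    using vpos \<rho> k unfolding req by (simp add: diff_divide_eq_iff)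
  have 3: "N / r = (1 + \<rho>) * k / \<rho>"
    using vpos \<rho> k unfolding req N by (simp add: field_simps)
  have 4: "N / r - 1 = t / \<rho>"
    using \<rho> unfolding 3 by (simp add: field_simps t_def)
  show "(1 - 1 / r) / (1 - 1 / N) = (1 + \<rho>) / \<rho>\<^sup>2 * (\<rho> - 1)"
    unfolding 1 2 using vpos \<rho> t by (simp add: field_simps power2_eq_square)
  show "(N / r - 1) / (r * (1 - 1 / N)) = (1 + \<rho>) / \<rho>\<^sup>2 * (k / \<rho>)"
    unfolding 1 4 unfolding req using vpos \<rho> t k by (simp add: field_simps power2_eq_square)
qed

section \<open>Steiner equiangular tight frames\<close>

text \<open>
  The row indices \<open>s j m\<close> stay in range, so a non-zero entry of the frame is an entry of \<open>H\<close>, of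
  modulus 1, scaled by \<open>\<rho>\<^sup>-\<^sup>1\<^sup>/\<^sup>2\<close>; neither \<open>H\<close> nor the choice of rows survives in the modulus.
\<close>

lemma steiner_etf_incidence:
  assumes w: "steiner_etf k v S \<B> w"
  obtains pt :: "nat \<Rightarrow> 'a" and blk :: "nat \<Rightarrow> 'a set" where
    "bij_betw pt {..<v} S" "bij_betw blk {..<card \<B>} \<B>"
    "\<And>i m. i < v * (1 + replication k v) \<Longrightarrow> m < card \<B> \<Longrightarrow>
      (cmod (w i $ m))\<^sup>2 = of_bool (pt (i div (1 + replication k v)) \<in> blk m) / real (replication k v)"
proof -
  define \<rho> where "\<rho> = replication k v"
  define b where "b = card \<B>"
  from w obtain pt blk H s where bij: "bij_betw pt {..<v} S" "bij_betw blk {..<b} \<B>"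
    and H: "hadamard (1 + \<rho>) H"
    and s: "row_choice (incidence_matrix v b pt blk) (1 + \<rho>) s"
    and w: "\<And>i. i < v * (1 + \<rho>) \<Longrightarrow> w i = col (steiner_matrix \<rho> (incidence_matrix v b pt blk) H s) i"
    unfolding steiner_etf_def \<rho>_def b_def by blast
  have "(cmod (w i $ m))\<^sup>2 = of_bool (pt (i div (1 + \<rho>)) \<in> blk m) / real \<rho>"
    if i: "i < v * (1 + \<rho>)" and m: "m < b" for i m
  proof -
    define j where "j = i div (1 + \<rho>)"
    have j: "j < v" unfolding j_def by (rule less_mult_imp_div_less[OF i])
    have M: "incidence_matrix v b pt blk $$ (j, m) = (if pt j \<in> blk m then 1 else 0)"
      and dims: "dim_row (incidence_matrix v b pt blk) = v" "dim_col (incidence_matrix v b pt blk) = b"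
      using j m by (simp_all add: incidence_matrix_def)
    have Hc: "dim_col H = 1 + \<rho>" using H unfolding hadamard_def by auto
    have mod: "i mod (1 + \<rho>) < 1 + \<rho>" by simp
    have "w i $ m = complex_of_real (1 / sqrt (real \<rho>)) *
        (if pt j \<in> blk m then H $$ (s j m, i mod (1 + \<rho>)) else 0)"
      using w[OF i] i m M dims Hc mod
      unfolding steiner_matrix_def steiner_block_def j_def by simp
    moreover have "cmod (H $$ (s j m, i mod (1 + \<rho>))) = 1" if "pt j \<in> blk m"
    proof -
      have "s j m < 1 + \<rho>"
        using s j m M that unfolding row_choice_def dims by auto
      then show ?thesis using H mod unfolding hadamard_def by auto
    qed
    ultimately show ?thesis
      by (auto simp: norm_mult norm_divide power_mult_distrib power_divide j_def)
  qed
  with bij show ?thesis using that unfolding \<rho>_def b_def by blast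
qed
lemma sum_div_blocks:
  fixes f :: "nat \<Rightarrow> 'b::comm_semiring_1"
  shows "(\<Sum>i<v * n. f (i div n)) = of_nat n * (\<Sum>j<v. f j)"
proof -
  have "(\<Sum>i<v * n. f (i div n)) = (\<Sum>j<v. \<Sum>i = j * n..<j * n + n. f (i div n))"
    by (simp add: sum.nat_group)
  also have "\<dots> = (\<Sum>j<v. \<Sum>i = j * n..<j * n + n. f j)"
  proof (intro sum.cong refl)
    fix j i assume "i \<in> {j * n..<j * n + n}"
    then have "i div n = j" by (intro div_nat_eqI) (auto simp: mult.commute)
    then show "f (i div n) = f j" by simp
  qed
  finally show ?thesis by (simp add: sum_distrib_left)
qed

theorem proposition3p2:
  fixes S :: "'a set" and \<B> :: "'a set set" and k v r N :: nat
    and w :: "nat \<Rightarrow> complex vec"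
  assumes "steiner_system k v S \<B>"
    and "2 \<le> k" and "k < v"
    and "r = card \<B>" and "N = v * (1 + replication k v)"
    and "steiner_etf k v S \<B> w"
    and "\<forall>i<N. \<forall>m<r. w i $ m \<in> \<real>"
  shows "kernel_dim (bound_matrix r N - R_matrix r N w) = v \<and>
    (finite_projective_plane k v S \<B> \<longrightarrow> R_matrix r N w = bound_matrix r N) \<and>
    (\<forall>d n u. 2 \<le> n \<and> equiangular_tight_frame d n u \<longrightarrow>
       loewner_le d (R_matrix d n u) (bound_matrix d n))"
proof -
  note st = assms(1)
  define \<rho> where "\<rho> = replication k v"
  define K Q V where "K = real k" and "Q = real \<rho>" and "V = real v"
  define g where "g = (1 + Q) / Q\<^sup>2"
  from steiner_etf_incidence[OF assms(6)] obtain pt blk where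
    pt: "bij_betw pt {..<v} S" and blk: "bij_betw blk {..<r} \<B>"
    and w: "\<And>i m. i < N \<Longrightarrow> m < r \<Longrightarrow>
      (cmod (w i $ m))\<^sup>2 = of_bool (pt (i div (1 + \<rho>)) \<in> blk m) / Q"
    unfolding assms(4,5) \<rho>_def Q_def by metis
  define I :: "nat \<Rightarrow> nat \<Rightarrow> real" where "I j m = of_bool (pt j \<in> blk m)" for j m
  have ptS: "pt j \<in> S" if "j < v" for j using pt that bij_betwE by blast
  have blkB: "blk m \<in> \<B>" if "m < r" for m using blk that bij_betwE by blast
  have cardB: "card B = k" "B \<subseteq> S" if "B \<in> \<B>" for B
    using st that unfolding steiner_system_def by auto
  have deg: "card {B \<in> \<B>. p \<in> B} = \<rho>" if "p \<in> S" for p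
    using steiner_point_degree[OF st that] assms(2) unfolding \<rho>_def replication_def
    by (metis One_nat_def Suc_le_eq diff_is_0_eq nonzero_mult_div_cancel_right not_less numeral_2_eq_2)
  have "0 < v" using assms(3) by simp
  have vk: "\<rho> * (k - 1) = v - 1"
    using steiner_point_degree[OF st ptS[OF \<open>0 < v\<close>]] deg[OF ptS[OF \<open>0 < v\<close>]] by simp
  have VK: "V - 1 = Q * (K - 1)"
    using arg_cong[OF vk, of real] assms(2,3) by (simp add: V_def Q_def K_def of_nat_diff)
  have K: "2 \<le> K" using assms(2) by (simp add: K_def)
  \<comment> \<open>This is where \<open>k < v\<close> enters: a single block would give \<open>\<rho> = 1\<close> and \<open>a = 0\<close>.\<close>
  have Q: "1 < Q"
  proof (rule ccontr)
    assume "\<not> 1 < Q"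
    then have "Q * (K - 1) \<le> 1 * (K - 1)" using K by (intro mult_right_mono) auto
    with VK have "V \<le> K" by simp
    then show False using assms(3) by (simp add: V_def K_def)
  qed
  have point: "(\<Sum>m<r. I j m) = Q" if "j < v" for j
    unfolding I_def using sum_of_bool_bij[OF blk] deg[OF ptS[OF that]] by (simp add: Q_def)
  have pair: "(\<Sum>m<r. I i m * I j m) = (if i = j then Q else 1)" if "i < v" "j < v" for i j
  proof -
    have "(\<Sum>m<r. I i m * I j m) = real (card {B \<in> \<B>. pt i \<in> B \<and> pt j \<in> B})"
      unfolding I_def of_bool_conj[symmetric] by (rule sum_of_bool_bij[OF blk])
    moreover have "pt i \<noteq> pt j" if "i \<noteq> j"
      using pt \<open>i < v\<close> \<open>j < v\<close> that by (auto simp: bij_betw_def inj_on_def)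
    ultimately show ?thesis
      using deg[OF ptS[OF \<open>i < v\<close>]] steiner_two_points[OF st ptS[OF \<open>i < v\<close>] ptS[OF \<open>j < v\<close>]]
      by (cases "i = j") (simp_all add: Q_def)
  qed
  have inter: "(\<Sum>j<v. I j m * I j l) = real (card (blk m \<inter> blk l))" if "m < r" for m l
  proof -
    have "(\<Sum>j<v. I j m * I j l) = real (card {p \<in> S. p \<in> blk m \<and> p \<in> blk l})"
      unfolding I_def of_bool_conj[symmetric] by (rule sum_of_bool_bij[OF pt])
    also have "{p \<in> S. p \<in> blk m \<and> p \<in> blk l} = blk m \<inter> blk l"
      using cardB(2)[OF blkB[OF that]] by auto
    finally show ?thesis .
  qed
  have block: "(\<Sum>j<v. I j m) = K" if "m < r" for m
    using inter[OF that, of m] cardB(1)[OF blkB[OF that]] by (simp add: I_def K_def flip: of_bool_conj)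
  have rk: "real r * K = V * Q"
  proof -
    have "real r * K = (\<Sum>m<r. \<Sum>j<v. I j m)" by (simp add: block)
    also have "\<dots> = (\<Sum>j<v. \<Sum>m<r. I j m)" by (rule sum.swap)
    also have "\<dots> = V * Q" by (simp add: point V_def)
    finally show ?thesis .
  qed
  have NV: "real N = V * (1 + Q)" by (simp add: assms(5) V_def Q_def \<rho>_def distrib_left)
  note scalars = steiner_scalars[OF K Q VK rk NV, folded g_def]
  have bound: "bound_matrix r N = mat r r (\<lambda>(m, l). (if m = l then g * (Q - 1) else 0) + g * (K / Q))"
    unfolding bound_matrix_def scalars by (rule eq_matI) auto
  have R_nth: "(\<Sum>i<N. (cmod (w i $ m))\<^sup>2 * (cmod (w i $ l))\<^sup>2) = g * (\<Sum>j<v. I j m * I j l)"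
    if "m < r" "l < r" for m l
  proof -
    have "(\<Sum>i<N. (cmod (w i $ m))\<^sup>2 * (cmod (w i $ l))\<^sup>2) =
        (\<Sum>i<v * (1 + \<rho>). (\<lambda>j. I j m * I j l / Q\<^sup>2) (i div (1 + \<rho>)))"
      using w that by (intro sum.cong) (auto simp: assms(5) \<rho>_def I_def power2_eq_square)
    also have "\<dots> = real (1 + \<rho>) * (\<Sum>j<v. I j m * I j l / Q\<^sup>2)"
      by (rule sum_div_blocks)
    also have "\<dots> = g * (\<Sum>j<v. I j m * I j l)"
      by (simp add: g_def Q_def flip: sum_divide_distrib)
    finally show ?thesis .
  qed
  have R: "R_matrix r N w = mat r r (\<lambda>(m, l). g * (\<Sum>j<v. I j m * I j l))"
    unfolding R_matrix_def by (rule eq_matI) (auto simp: R_nth)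
  have g: "0 < g" using Q by (simp add: g_def)
  have "kernel_dim (bound_matrix r N - R_matrix r N w) = v"
  proof -
    have "bound_matrix r N - R_matrix r N w = mat r r (\<lambda>(m, l).
        (if m = l then g * (Q - 1) else 0) + g * (K / Q) - g * (\<Sum>j<v. I j m * I j l))"
      unfolding bound R by (rule eq_matI) auto
    then show ?thesis
      using incidence_kernel_dim[OF point block pair Q _ g refl refl] K by simp
  qed
  moreover have "R_matrix r N w = bound_matrix r N" if fpp: "finite_projective_plane k v S \<B>"
  proof -
    have one: "\<forall>B\<in>\<B>. \<forall>B'\<in>\<B>. B \<noteq> B' \<longrightarrow> card (B \<inter> B') = 1"
      using fpp unfolding finite_projective_plane_def by (elim conjE)
    have meet: "(\<Sum>j<v. I j m * I j l) = (if m = l then K else 1)" if "m < r" "l < r" for m l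
    proof (cases "m = l")
      case True
      then show ?thesis using inter[OF that(1)] cardB(1)[OF blkB[OF that(1)]] by (simp add: K_def)
    next
      case False
      then have "blk m \<noteq> blk l" using blk that by (auto simp: bij_betw_def inj_on_def)
      then have "card (blk m \<inter> blk l) = 1"
        using one blkB[OF that(1)] blkB[OF that(2)] by simp
      then show ?thesis using inter[OF that(1)] False by simp
    qed
    have "0 < r" using rk K Q \<open>0 < v\<close> by (intro Nat.gr0I) (auto simp: V_def)
    \<comment> \<open>The sum of a row of \<open>M\<^sup>T M\<close>, computed in two ways.\<close>
    have "K - 1 + real r = Q * K"
    proof -
      have "K - 1 + real r = (\<Sum>l<r. (if l = 0 then K - 1 else 0) + 1)"
        using \<open>0 < r\<close> by (simp add: sum.distrib)
      also have "\<dots> = (\<Sum>l<r. \<Sum>j<v. I j 0 * I j l)"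
        using meet[OF \<open>0 < r\<close>] by (intro sum.cong refl) auto
      also have "\<dots> = (\<Sum>j<v. I j 0 * (\<Sum>l<r. I j l))"
        by (subst sum.swap) (simp add: sum_distrib_left)
      also have "\<dots> = Q * K"
        by (simp add: point block[OF \<open>0 < r\<close>] flip: sum_distrib_right)
      finally show ?thesis .
    qed
    \<comment> \<open>Eliminating \<open>r\<close> and \<open>v\<close> leaves a polynomial identity with the factor \<open>K - Q\<close>.\<close>
    then have "real r = Q * K - K + 1" by simp
    moreover have "V = 1 + Q * (K - 1)" using VK by simp
    ultimately have "(Q * K - K + 1) * K = (1 + Q * (K - 1)) * Q" using rk by simp
    then have "(K - Q) * ((K - 1) * (Q - 1)) = 0" by (simp add: algebra_simps)
    then have "K = Q" using K Q by simp
    then show ?thesis unfolding bound R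
      using meet Q by (intro eq_matI) (auto simp: algebra_simps)
  qed
  ultimately show ?thesis using etf_loewner_bound by blast
qed

end
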